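(* For every integer $n \ge 2$, the intermediate rank of the semigroup $A^+(B_n)$ satisfies $r_3(A^+(B_n)) \ge 2n$.
   Context: Brandt semigroup. For $n\ge 1$ let $[n]=\{1,\dots,n\}$ and $B_n = ([n]\times[n])\cup\{\vartheta\}$, with the (non-commutative) operation $+$ given by $(i,j)+(k,l)=(i,l)$ if $j=k$ and $(i,j)+(k,l)=\vartheta$ otherwise, and $\vartheta+x=x+\vartheta=\vartheta$ for all $x\in B_n$. Affine maps. Arguments of functions are written on the left ($xf$ is the value of $f$ at $x$), so $x(fg)=(xf)g$. Let $M(B_n)$ be the set of all maps $B_n\to B_n$, with pointwise addition $+$ and composition. A map is affine if it equals $g+h$ with $g$ an endomorphism of $(B_n,+)$ and $h$ a constant map; $\mathrm{Aff}(B_n)$ is the set of affine maps. $A^+(B_n)$ is the smallest subset of $M(B_n)$ containing $\mathrm{Aff}(B_n)$ and closed under $+$ and composition; here it is regarded as a semigroup under composition only. Explicit description (known). For $c\in B_n$ let $\xi_c$ be the constant map with value $c$; for $k,l,p,q\in[n]$ let ${}^{(k,l)}\zeta_{(p,q)}$ be the map sending $(k,l)$ to $(p,q)$ and all other elements to $\vartheta$; for $p,q\in[n]$ and a permutation $\sigma\in S_n$ let $(p,q;\sigma)$ be the map sending $(i,p)$ to $(i\sigma,q)$ for all $i\in[n]$ and all other elements to $\vartheta$. For $n\ge 2$, $A^+(B_n)=\{(p,q;\sigma): p,q\in[n],\sigma\in S_n\}\cup\{\xi_c : c\in B_n\}\cup\{{}^{(k,l)}\zeta_{(p,q)}: k,l,p,q\in[n]\}$.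 Rank. A subset $U$ of a semigroup $\Gamma$ is independent if $a\notin\langle U\setminus\{a\}\rangle$ for every $a\in U$, where $\langle X\rangle$ is the subsemigroup generated by $X$ (with $\langle\emptyset\rangle=\emptyset$). For a finite semigroup $\Gamma$, the intermediate rank is $r_3(\Gamma)=\max\{|U| : U\subseteq\Gamma,\ \langle U\rangle=\Gamma,\ U\text{ is independent}\}$. *)

theory Defs
  imports Main "HOL-Library.FuncSet"
begin

text \<open>Finite semigroups are given by a carrier set together with a binary operation.\<close>

inductive_set subsemigroup_gen :: "('a \<Rightarrow> 'a \<Rightarrow> 'a) \<Rightarrow> 'a set \<Rightarrow> 'a set"
  for mul :: "'a \<Rightarrow> 'a \<Rightarrow> 'a" and X :: "'a set"
  where
    base: "x \<in> X \<Longrightarrow> x \<in> subsemigroup_gen mul X"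
  | mult: "x \<in> subsemigroup_gen mul X \<Longrightarrow> y \<in> subsemigroup_gen mul X \<Longrightarrow>
      mul x y \<in> subsemigroup_gen mul X"

definition semigroup_independent :: "('a \<Rightarrow> 'a \<Rightarrow> 'a) \<Rightarrow> 'a set \<Rightarrow> bool" where
  "semigroup_independent mul U \<longleftrightarrow> (\<forall>a\<in>U. a \<notin> subsemigroup_gen mul (U - {a}))"

text \<open>Meaningful for finite carriers \<open>S\<close>: then the set below is finite, and it is nonempty
  because a generating set that is minimal under inclusion is independent.\<close>

definition intermediate_rank :: "'a set \<Rightarrow> ('a \<Rightarrow> 'a \<Rightarrow> 'a) \<Rightarrow> nat" where
  "intermediate_rank S mul =
    Max {card U | U. U \<subseteq> S \<and> subsemigroup_gen mul U = S \<and> semigroup_independent mul U}"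

text \<open>In \<open>brandt n\<close> the element \<open>\<vartheta>\<close> is \<open>None\<close> and the pair \<open>(i, j)\<close> is
  \<open>Some (i, j)\<close>.\<close>

type_synonym brandt_elem = "(nat \<times> nat) option"

definition brandt :: "nat \<Rightarrow> brandt_elem set" where
  "brandt n = insert None (Some ` ({1..n} \<times> {1..n}))"

fun brandt_add :: "brandt_elem \<Rightarrow> brandt_elem \<Rightarrow> brandt_elem" where
  "brandt_add (Some (i, j)) (Some (k, l)) = (if j = k then Some (i, l) else None)"
| "brandt_add _ _ = None"

text \<open>Self-maps of \<open>brandt n\<close> are represented by the functions in
  \<^term>\<open>brandt n \<rightarrow>\<^sub>E brandt n\<close>, which are undefined outside \<open>brandt n\<close>,
  so that equality of such functions is equality of maps.\<close>

definition brandt_maps :: "nat \<Rightarrow> (brandt_elem \<Rightarrow> brandt_elem) set" where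
  "brandt_maps n = brandt n \<rightarrow>\<^sub>E brandt n"

definition map_sum ::
    "nat \<Rightarrow> (brandt_elem \<Rightarrow> brandt_elem) \<Rightarrow> (brandt_elem \<Rightarrow> brandt_elem) \<Rightarrow>
      brandt_elem \<Rightarrow> brandt_elem" where
  "map_sum n f g = (\<lambda>x\<in>brandt n. brandt_add (f x) (g x))"

text \<open>Maps act on the right: in \<open>map_mult n f g\<close> first \<open>f\<close> is applied, then \<open>g\<close>.\<close>

definition map_mult ::
    "nat \<Rightarrow> (brandt_elem \<Rightarrow> brandt_elem) \<Rightarrow> (brandt_elem \<Rightarrow> brandt_elem) \<Rightarrow>
      brandt_elem \<Rightarrow> brandt_elem" where
  "map_mult n f g = compose (brandt n) g f"

definition brandt_endo :: "nat \<Rightarrow> (brandt_elem \<Rightarrow> brandt_elem) set" where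
  "brandt_endo n = {f \<in> brandt_maps n.
    \<forall>x\<in>brandt n. \<forall>y\<in>brandt n. f (brandt_add x y) = brandt_add (f x) (f y)}"

definition const_map :: "nat \<Rightarrow> brandt_elem \<Rightarrow> brandt_elem \<Rightarrow> brandt_elem" where
  "const_map n c = (\<lambda>x\<in>brandt n. c)"

definition affine_maps :: "nat \<Rightarrow> (brandt_elem \<Rightarrow> brandt_elem) set" where
  "affine_maps n = {map_sum n g (const_map n c) | g c. g \<in> brandt_endo n \<and> c \<in> brandt n}"

inductive_set A_plus :: "nat \<Rightarrow> (brandt_elem \<Rightarrow> brandt_elem) set"
  for n :: nat
  where
    affine: "f \<in> affine_maps n \<Longrightarrow> f \<in> A_plus n"
  | sum: "f \<in> A_plus n \<Longrightarrow> g \<in> A_plus n \<Longrightarrow> map_sum n f g \<in> A_plus n"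
  | mult: "f \<in> A_plus n \<Longrightarrow> g \<in> A_plus n \<Longrightarrow> map_mult n f g \<in> A_plus n"

end

theory Submission
  imports Defs "HOL-Combinatorics.Permutations"
begin

text \<open>The witness consists of the maps \<open>(1, j; (1 j))\<close> and \<open>(j, 1; id)\<close> for \<open>2 \<le> j \<le> n\<close>, together
  with one \<open>\<zeta>\<close> and one nonzero constant. Going from \<open>1\<close> to \<open>j\<close> and back yields the
  loop \<open>(1, 1; (1 j))\<close>, and the transpositions \<open>(1 j)\<close> generate the symmetric group, so all maps
  \<open>(p, q; \<sigma>)\<close> are obtained; multiplying the \<open>\<zeta>\<close> and the constant by these gives the rest.
  No generator is redundant: without \<open>(1, j; (1 j))\<close> no map \<open>(p, j; \<sigma>)\<close> can be reached, without
  \<open>(j, 1; id)\<close> no map \<open>(j, q; \<sigma>)\<close>, without the \<open>\<zeta>\<close> no nonzero map of one-point support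
  fixing \<open>\<vartheta>\<close>, and without the constant every product fixes \<open>\<vartheta>\<close>.\<close>

text \<open>Keeps \<open>1\<close> from becoming \<open>Suc 0\<close>: the intervals
  \<open>{1..n}\<close>, the hub column and the transpositions are all written with
  \<open>1\<close>.\<close>

declare One_nat_def [simp del]

section \<open>Elements of \<open>brandt n\<close> and its self-maps\<close>

lemma None_in_brandt [simp]: "None \<in> brandt n"
  by (simp add: brandt_def)

lemma Some_in_brandt [simp]: "Some (i, j) \<in> brandt n \<longleftrightarrow> i \<in> {1..n} \<and> j \<in> {1..n}"
  by (auto simp: brandt_def)

lemma finite_brandt: "finite (brandt n)"
  by (simp add: brandt_def)

lemma brandt_cases:
  assumes "x \<in> brandt n"
  obtains (zero) "x = None"
  | (pair) i j where "x = Some (i, j)" "i \<in> {1..n}" "j \<in> {1..n}"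
  using assms by (auto simp: brandt_def)

lemma brandt_SomeE:
  assumes "x \<in> brandt n" "x \<noteq> None"
  obtains a where "x = Some a" "a \<in> {1..n} \<times> {1..n}"
  using assms by (auto simp: brandt_def)

lemma brandt_add_None_right [simp]: "brandt_add x None = None"
  by (cases x) auto

lemma brandt_add_closed [intro]:
  "x \<in> brandt n \<Longrightarrow> y \<in> brandt n \<Longrightarrow> brandt_add x y \<in> brandt n"
  by (elim brandt_cases) auto

lemma brandt_maps_eqI:
  assumes "f \<in> brandt_maps n" "g \<in> brandt_maps n" "f None = g None"
    and "\<And>i j. i \<in> {1..n} \<Longrightarrow> j \<in> {1..n} \<Longrightarrow> f (Some (i, j)) = g (Some (i, j))"
  shows "f = g"
proof (rule PiE_ext)
  show "f \<in> brandt n \<rightarrow>\<^sub>E brandt n" "g \<in> brandt n \<rightarrow>\<^sub>E brandt n"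
    using assms by (simp_all add: brandt_maps_def)
  show "f x = g x" if "x \<in> brandt n" for x
    using that assms(3,4) by (cases rule: brandt_cases) auto
qed

lemma brandt_maps_closed: "f \<in> brandt_maps n \<Longrightarrow> x \<in> brandt n \<Longrightarrow> f x \<in> brandt n"
  by (auto simp: brandt_maps_def)

lemma map_sum_apply [simp]: "x \<in> brandt n \<Longrightarrow> map_sum n f g x = brandt_add (f x) (g x)"
  by (simp add: map_sum_def)

lemma map_mult_apply [simp]: "x \<in> brandt n \<Longrightarrow> map_mult n f g x = g (f x)"
  by (simp add: map_mult_def compose_def)

lemma const_map_apply [simp]: "x \<in> brandt n \<Longrightarrow> const_map n c x = c"
  by (simp add: const_map_def)

lemma map_sum_in_brandt_maps [intro]:
  "f \<in> brandt_maps n \<Longrightarrow> g \<in> brandt_maps n \<Longrightarrow> map_sum n f g \<in> brandt_maps n"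
  by (auto simp: brandt_maps_def map_sum_def)

lemma map_mult_in_brandt_maps [intro]:
  "f \<in> brandt_maps n \<Longrightarrow> g \<in> brandt_maps n \<Longrightarrow> map_mult n f g \<in> brandt_maps n"
  by (auto simp: brandt_maps_def map_mult_def compose_def)

lemma const_map_in_brandt_maps [intro]: "c \<in> brandt n \<Longrightarrow> const_map n c \<in> brandt_maps n"
  by (auto simp: brandt_maps_def const_map_def)

lemma map_mult_const_right:
  "f \<in> brandt_maps n \<Longrightarrow> c \<in> brandt n \<Longrightarrow> map_mult n f (const_map n c) = const_map n c"
  by (rule brandt_maps_eqI[of _ n]) (auto simp: brandt_maps_closed)

lemma map_mult_const_left:
  "f \<in> brandt_maps n \<Longrightarrow> c \<in> brandt n \<Longrightarrow> map_mult n (const_map n c) f = const_map n (f c)"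
  by (rule brandt_maps_eqI[of _ n]) (auto simp: brandt_maps_closed)

section \<open>Column maps, point maps and their supports\<close>

text \<open>The maps \<open>(p, q; \<sigma>)\<close> of the paper.\<close>

definition column_map :: "nat \<Rightarrow> nat \<Rightarrow> nat \<Rightarrow> (nat \<Rightarrow> nat) \<Rightarrow> brandt_elem \<Rightarrow> brandt_elem" where
  "column_map n p q \<sigma> = (\<lambda>x\<in>brandt n. case x of None \<Rightarrow> None
     | Some (i, j) \<Rightarrow> if j = p then Some (\<sigma> i, q) else None)"

text \<open>The maps \<open>\<zeta>\<close> of the paper.\<close>

definition point_map :: "nat \<Rightarrow> nat \<times> nat \<Rightarrow> nat \<times> nat \<Rightarrow> brandt_elem \<Rightarrow> brandt_elem" where
  "point_map n a b = (\<lambda>x\<in>brandt n. if x = Some a then Some b else None)"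

definition column_maps :: "nat \<Rightarrow> (brandt_elem \<Rightarrow> brandt_elem) set" where
  "column_maps n =
    {column_map n p q \<sigma> | p q \<sigma>. p \<in> {1..n} \<and> q \<in> {1..n} \<and> \<sigma> permutes {1..n}}"

definition point_maps :: "nat \<Rightarrow> (brandt_elem \<Rightarrow> brandt_elem) set" where
  "point_maps n = {point_map n a b | a b. a \<in> {1..n} \<times> {1..n} \<and> b \<in> {1..n} \<times> {1..n}}"

text \<open>Zetas may multiply or add up to zero, so the zero constant is included. The result is
  exactly the class of self-maps fixing \<open>None\<close> and nonzero in at most one
  point.\<close>

definition thin_maps :: "nat \<Rightarrow> (brandt_elem \<Rightarrow> brandt_elem) set" where
  "thin_maps n = insert (const_map n None) (point_maps n)"

lemma column_map_apply [simp]: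
  "column_map n p q \<sigma> None = None"
  "i \<in> {1..n} \<Longrightarrow> j \<in> {1..n} \<Longrightarrow>
    column_map n p q \<sigma> (Some (i, j)) = (if j = p then Some (\<sigma> i, q) else None)"
  by (auto simp: column_map_def)

lemma point_map_apply [simp]:
  "x \<in> brandt n \<Longrightarrow> point_map n a b x = (if x = Some a then Some b else None)"
  by (simp add: point_map_def)

lemma column_map_in_brandt_maps [intro]:
  assumes "q \<in> {1..n}" "\<sigma> permutes {1..n}"
  shows "column_map n p q \<sigma> \<in> brandt_maps n"
  using assms permutes_in_image[OF assms(2)]
  by (auto simp: brandt_maps_def column_map_def brandt_def split: option.splits)

lemma point_map_in_brandt_maps [intro]:
  "b \<in> {1..n} \<times> {1..n} \<Longrightarrow> point_map n a b \<in> brandt_maps n"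
  by (auto simp: brandt_maps_def point_map_def)

lemma column_mapsI [intro]:
  "p \<in> {1..n} \<Longrightarrow> q \<in> {1..n} \<Longrightarrow> \<sigma> permutes {1..n} \<Longrightarrow> column_map n p q \<sigma> \<in> column_maps n"
  by (auto simp: column_maps_def)

lemma column_mapsE:
  assumes "f \<in> column_maps n"
  obtains p q \<sigma> where "f = column_map n p q \<sigma>" "p \<in> {1..n}" "q \<in> {1..n}" "\<sigma> permutes {1..n}"
  using assms by (auto simp: column_maps_def)

lemma column_maps_subset: "column_maps n \<subseteq> brandt_maps n"
  by (auto simp: column_maps_def)

lemma thin_maps_subset: "thin_maps n \<subseteq> brandt_maps n"
  by (auto simp: thin_maps_def point_maps_def)

lemma const_maps_subset: "const_map n ` brandt n \<subseteq> brandt_maps n"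
  by auto

lemma point_map_thin:
  "a \<in> {1..n} \<times> {1..n} \<Longrightarrow> b \<in> {1..n} \<times> {1..n} \<Longrightarrow> point_map n a b \<in> thin_maps n"
  unfolding thin_maps_def point_maps_def by blast

text \<open>A point where \<open>f\<close> is nonzero and its value there supply the two labels of a
  zeta; without such a point \<open>f\<close> is the zero constant. Closure proofs can thus argue by
  size of support.\<close>

lemma thin_mapsI:
  assumes f: "f \<in> brandt_maps n" and "f None = None"
    and one: "\<And>x y. x \<in> brandt n \<Longrightarrow> y \<in> brandt n \<Longrightarrow> f x \<noteq> None \<Longrightarrow> f y \<noteq> None \<Longrightarrow> x = y"
  shows "f \<in> thin_maps n"
proof (cases "\<exists>x\<in>brandt n. f x \<noteq> None")
  case True
  then obtain x where x: "x \<in> brandt n" "f x \<noteq> None" by blast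
  have "x \<noteq> None" using assms(2) x(2) by metis
  with x(1) obtain a where a: "x = Some a" "a \<in> {1..n} \<times> {1..n}"
    by (rule brandt_SomeE)
  obtain b where b: "f x = Some b" "b \<in> {1..n} \<times> {1..n}"
    using brandt_maps_closed[OF f x(1)] x(2) by (rule brandt_SomeE)
  have "f = point_map n a b"
  proof (rule brandt_maps_eqI[OF f])
    show "point_map n a b \<in> brandt_maps n" using b by blast
    show "f None = point_map n a b None" using assms(2) by simp
    show "f (Some (i, j)) = point_map n a b (Some (i, j))" if "i \<in> {1..n}" "j \<in> {1..n}" for i j
    proof (cases "x = Some (i, j)")
      case True
      then show ?thesis using a b that by simp
    next
      case False
      then have "f (Some (i, j)) = None" using one[OF x(1)] x(2) that by (metis Some_in_brandt)
      then show ?thesis using False a that by simp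
    qed
  qed
  then show ?thesis using a(2) b(2) by (simp add: point_map_thin)
next
  case False
  have "f = const_map n None"
  proof (rule brandt_maps_eqI[OF f])
    show "f (Some (i, j)) = const_map n None (Some (i, j))" if "i \<in> {1..n}" "j \<in> {1..n}" for i j
      using False that by (metis Some_in_brandt const_map_apply)
  qed (use assms(2) in auto)
  then show ?thesis by (simp add: thin_maps_def)
qed

lemma thin_maps_None [simp]: "f \<in> thin_maps n \<Longrightarrow> f None = None"
  by (auto simp: thin_maps_def point_maps_def)

lemma thin_mapsD:
  "f \<in> thin_maps n \<Longrightarrow> x \<in> brandt n \<Longrightarrow> y \<in> brandt n \<Longrightarrow> f x \<noteq> None \<Longrightarrow> f y \<noteq> None \<Longrightarrow> x = y"
  by (auto simp: thin_maps_def point_maps_def split: if_splits)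

lemma column_maps_None [simp]: "f \<in> column_maps n \<Longrightarrow> f None = None"
  by (auto simp: column_maps_def)

section \<open>Products of the described maps\<close>

text \<open>The first factor lands in column \<open>q\<close> or at \<open>None\<close>, and the
  second vanishes off column \<open>r\<close>. The first factor acts first, hence the order
  \<open>\<tau> \<circ> \<sigma>\<close>.\<close>

lemma column_map_mult:
  assumes "q \<in> {1..n}" "s \<in> {1..n}" "\<sigma> permutes {1..n}" "\<tau> permutes {1..n}"
  shows "map_mult n (column_map n p q \<sigma>) (column_map n r s \<tau>) =
    (if q = r then column_map n p s (\<tau> \<circ> \<sigma>) else const_map n None)"
proof (rule brandt_maps_eqI[of _ n])
  show "(if q = r then column_map n p s (\<tau> \<circ> \<sigma>) else const_map n None) \<in> brandt_maps n"
    using assms by (auto intro: permutes_compose)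
  show "map_mult n (column_map n p q \<sigma>) (column_map n r s \<tau>) \<in> brandt_maps n"
    using assms by blast
qed (use assms permutes_in_image[OF assms(3)] in auto)

text \<open>Following \<open>f\<close> by a map that fixes \<open>None\<close> cannot enlarge the
  support.\<close>

lemma thin_maps_mult_right:
  assumes f: "f \<in> thin_maps n" and g: "g \<in> brandt_maps n" "g None = None"
  shows "map_mult n f g \<in> thin_maps n"
proof (rule thin_mapsI)
  show "map_mult n f g \<in> brandt_maps n" using f g thin_maps_subset by blast
  show "map_mult n f g None = None" using f g by simp
  show "x = y" if "x \<in> brandt n" "y \<in> brandt n"
    "map_mult n f g x \<noteq> None" "map_mult n f g y \<noteq> None" for x y
  proof (rule thin_mapsD[OF f that(1,2)])
    show "f x \<noteq> None" "f y \<noteq> None" using that g(2) by (metis map_mult_apply)+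
  qed
qed

text \<open>Nonzero values come from a single column, on which the permutation is injective.\<close>

lemma column_map_inj:
  assumes f: "f \<in> column_maps n" and "x \<in> brandt n" "y \<in> brandt n" "f x = f y" "f x \<noteq> None"
  shows "x = y"
proof -
  obtain p q \<sigma> where *: "f = column_map n p q \<sigma>" "\<sigma> permutes {1..n}"
    using f by (rule column_mapsE)
  show ?thesis
    using assms(2-5) unfolding *(1)
    by (auto elim!: brandt_cases split: if_splits simp: inj_eq[OF permutes_inj[OF *(2)]])
qed

text \<open>The product is nonzero only where \<open>f\<close> hits the support point of
  \<open>g\<close>, and \<open>f\<close> hits a nonzero point at most once.\<close>

lemma column_maps_mult_thin:
  assumes f: "f \<in> column_maps n" and g: "g \<in> thin_maps n"
  shows "map_mult n f g \<in> thin_maps n"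
proof (rule thin_mapsI)
  have fm: "f \<in> brandt_maps n" using f column_maps_subset by blast
  show "map_mult n f g \<in> brandt_maps n" using fm g thin_maps_subset by blast
  show "map_mult n f g None = None" using f g by simp
  show "x = y" if "x \<in> brandt n" "y \<in> brandt n"
    "map_mult n f g x \<noteq> None" "map_mult n f g y \<noteq> None" for x y
  proof (rule column_map_inj[OF f that(1,2)])
    show "f x = f y"
      using thin_mapsD[OF g] that brandt_maps_closed[OF fm] by simp
    show "f x \<noteq> None" using that g by (metis map_mult_apply thin_maps_None)
  qed
qed

text \<open>The right-hand side of the known description of \<open>A_plus n\<close>; the zero
  constant lies in two of the pieces. Equality for \<open>n \<ge> 2\<close> comes out of the
  inclusions behind \<open>gens_generate\<close>.\<close>

definition described_maps :: "nat \<Rightarrow> (brandt_elem \<Rightarrow> brandt_elem) set" where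
  "described_maps n = column_maps n \<union> thin_maps n \<union> const_map n ` brandt n"

lemma described_maps_subset: "described_maps n \<subseteq> brandt_maps n"
  unfolding described_maps_def
  using column_maps_subset thin_maps_subset const_maps_subset by blast

lemma const_None_thin: "const_map n None \<in> thin_maps n"
  by (simp add: thin_maps_def)

lemma column_maps_mult:
  "f \<in> column_maps n \<Longrightarrow> g \<in> column_maps n \<Longrightarrow> map_mult n f g \<in> column_maps n \<union> thin_maps n"
  by (elim column_mapsE) (auto simp: column_map_mult const_None_thin intro: permutes_compose)

text \<open>A thin factor makes the product thin, so only products inside \<open>C\<close> need
  checking. A general \<open>C\<close> allows families with restricted columns.\<close>

lemma zero_preserving_mult:
  assumes "C \<subseteq> column_maps n"
    and "\<And>f g. f \<in> C \<Longrightarrow> g \<in> C \<Longrightarrow> map_mult n f g \<in> C \<union> thin_maps n"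
    and "f \<in> C \<union> thin_maps n" "g \<in> C \<union> thin_maps n"
  shows "map_mult n f g \<in> C \<union> thin_maps n"
proof -
  have g: "g \<in> brandt_maps n" "g None = None"
    using assms(1,4) column_maps_subset[of n] thin_maps_subset[of n] by auto
  consider "f \<in> C" "g \<in> C" | "f \<in> C" "g \<in> thin_maps n" | "f \<in> thin_maps n"
    using assms(3,4) by blast
  then show ?thesis
    using assms(1,2) column_maps_mult_thin thin_maps_mult_right[OF _ g] by cases blast+
qed

text \<open>Constants are right zeros, and a constant followed by any self-map is constant. Products
  within \<open>D\<close> may fall into the constants, since column maps can multiply to
  zero.\<close>

lemma consts_mult:
  assumes "D \<subseteq> brandt_maps n"
    and "\<And>f g. f \<in> D \<Longrightarrow> g \<in> D \<Longrightarrow> map_mult n f g \<in> D \<union> const_map n ` brandt n"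
    and "f \<in> D \<union> const_map n ` brandt n" "g \<in> D \<union> const_map n ` brandt n"
  shows "map_mult n f g \<in> D \<union> const_map n ` brandt n"
proof -
  have m: "f \<in> brandt_maps n" "g \<in> brandt_maps n"
    using assms(1,3,4) const_maps_subset by blast+
  consider "g \<in> const_map n ` brandt n" | "f \<in> const_map n ` brandt n" | "f \<in> D" "g \<in> D"
    using assms(3,4) by blast
  then show ?thesis
    using assms(2) map_mult_const_right[OF m(1)] map_mult_const_left[OF m(2)]
      brandt_maps_closed[OF m(2)]
    by cases auto
qed

text \<open>Serves twice: with all column maps for \<open>described_maps\<close>, and with
  restricted families to build subsemigroups that miss a chosen generator.\<close>

lemma columns_thin_consts_mult:
  assumes "C \<subseteq> column_maps n"
    and "\<And>f g. f \<in> C \<Longrightarrow> g \<in> C \<Longrightarrow> map_mult n f g \<in> C \<union> thin_maps n"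
    and "f \<in> C \<union> thin_maps n \<union> const_map n ` brandt n"
    and "g \<in> C \<union> thin_maps n \<union> const_map n ` brandt n"
  shows "map_mult n f g \<in> C \<union> thin_maps n \<union> const_map n ` brandt n"
proof (rule consts_mult[OF _ _ assms(3,4)])
  show "C \<union> thin_maps n \<subseteq> brandt_maps n"
    using assms(1) column_maps_subset thin_maps_subset by blast
qed (use zero_preserving_mult[OF assms(1,2)] in blast)

lemma described_maps_mult:
  "f \<in> described_maps n \<Longrightarrow> g \<in> described_maps n \<Longrightarrow> map_mult n f g \<in> described_maps n"
  unfolding described_maps_def
  using columns_thin_consts_mult[OF subset_refl column_maps_mult] .

section \<open>Pointwise sums of the described maps\<close>

lemma map_sum_thin:
  assumes "f \<in> brandt_maps n" "g \<in> brandt_maps n" "f \<in> thin_maps n \<or> g \<in> thin_maps n"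
  shows "map_sum n f g \<in> thin_maps n"
proof (rule thin_mapsI)
  show "map_sum n f g \<in> brandt_maps n" using assms by blast
  show "map_sum n f g None = None" using assms(3) by auto
  show "x = y" if "x \<in> brandt n" "y \<in> brandt n"
    "map_sum n f g x \<noteq> None" "map_sum n f g y \<noteq> None" for x y
  proof -
    have "f x \<noteq> None" "f y \<noteq> None" "g x \<noteq> None" "g y \<noteq> None"
      using that by (metis map_sum_apply brandt_add.simps(2) brandt_add_None_right)+
    with assms(3) that(1,2) show ?thesis by (auto dest: thin_mapsD)
  qed
qed

text \<open>If \<open>g\<close> is \<open>(r, s; \<tau>)\<close>, then the sum can only be nonzero at \<open>(i, r)\<close> with \<open>i\<tau> = q\<close>.\<close>

lemma map_sum_column_thin:
  assumes f: "f \<in> brandt_maps n" and g: "g \<in> column_maps n"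
    and col: "\<And>x i j. x \<in> brandt n \<Longrightarrow> f x = Some (i, j) \<Longrightarrow> j = q"
  shows "map_sum n f g \<in> thin_maps n"
proof (rule thin_mapsI)
  obtain r s \<tau> where *: "g = column_map n r s \<tau>" "r \<in> {1..n}" "s \<in> {1..n}" "\<tau> permutes {1..n}"
    using g by (rule column_mapsE)
  show "map_sum n f g \<in> brandt_maps n" using f g column_maps_subset by blast
  show "map_sum n f g None = None" using g by simp
  have key: "g x = Some (q, s)" if x: "x \<in> brandt n" and "map_sum n f g x \<noteq> None" for x
  proof -
    from that obtain a b where ab: "f x = Some a" "g x = Some b"
      by (cases "f x"; cases "g x") auto
    moreover obtain i j where "a = (i, j)" by fastforce
    moreover have "snd b = s" using ab(2) x unfolding *(1)
      by (auto elim!: brandt_cases split: if_splits)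
    ultimately show ?thesis
      using that col[OF x] by (cases b) (auto split: if_splits)
  qed
  show "x = y" if "x \<in> brandt n" "y \<in> brandt n"
    "map_sum n f g x \<noteq> None" "map_sum n f g y \<noteq> None" for x y
    using column_map_inj[OF g that(1,2)] key[OF that(1,3)] key[OF that(2,4)] by simp
qed

lemma map_sum_const:
  "c \<in> brandt n \<Longrightarrow> d \<in> brandt n \<Longrightarrow>
    map_sum n (const_map n c) (const_map n d) = const_map n (brandt_add c d)"
  by (rule brandt_maps_eqI[of _ n]) auto

lemma map_sum_column_const:
  assumes "q \<in> {1..n}" "\<sigma> permutes {1..n}" "Some (k, l) \<in> brandt n"
  shows "map_sum n (column_map n p q \<sigma>) (const_map n (Some (k, l))) =
    (if q = k then column_map n p l \<sigma> else const_map n None)"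
proof (rule brandt_maps_eqI[of _ n])
  show "map_sum n (column_map n p q \<sigma>) (const_map n (Some (k, l))) \<in> brandt_maps n"
    using assms by blast
qed (use assms in auto)

text \<open>Order matters when a column map meets a constant: on the right the constant only
  replaces the target column or annihilates, on the left it selects at most one entry of the column.
  Likewise the target column of one column map selects one entry of the next.\<close>

lemma described_maps_sum:
  assumes "f \<in> described_maps n" "g \<in> described_maps n"
  shows "map_sum n f g \<in> described_maps n"
proof -
  have m: "f \<in> brandt_maps n" "g \<in> brandt_maps n"
    using assms described_maps_subset by blast+
  consider "f \<in> thin_maps n \<or> g \<in> thin_maps n"
    | "f \<in> column_maps n" "g \<in> column_maps n"
    | (const_column) "f \<in> const_map n ` brandt n" "g \<in> column_maps n"
    | (column_const) "f \<in> column_maps n" "g \<in> const_map n ` brandt n"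
    | (const) "f \<in> const_map n ` brandt n" "g \<in> const_map n ` brandt n"
    using assms by (auto simp: described_maps_def)
  then show ?thesis
  proof cases
    case 1
    then show ?thesis using map_sum_thin[OF m] by (auto simp: described_maps_def)
  next
    case 2
    from 2(1) obtain p q \<sigma> where f: "f = column_map n p q \<sigma>" by (rule column_mapsE)
    have "map_sum n f g \<in> thin_maps n"
      by (rule map_sum_column_thin[OF m(1) 2(2), of q])
        (auto simp: f elim!: brandt_cases split: if_splits)
    then show ?thesis by (auto simp: described_maps_def)
  next
    case const_column
    then obtain c where c: "f = const_map n c" by blast
    \<comment> \<open>All nonzero values of \<open>f\<close> share the second coordinate of
      \<open>c\<close>; for \<open>c = None\<close> there are none, so the arbitrary value of
      \<open>the\<close> does no harm.\<close>
    have "map_sum n f g \<in> thin_maps n"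
      by (rule map_sum_column_thin[OF m(1) const_column(2), of "snd (the c)"]) (auto simp: c)
    then show ?thesis by (auto simp: described_maps_def)
  next
    case column_const
    from column_const(2) obtain c where c: "g = const_map n c" "c \<in> brandt n" by blast
    show ?thesis
    proof (cases c)
      case None
      then show ?thesis
        using map_sum_thin[OF m] c const_None_thin by (auto simp: described_maps_def)
    next
      case (Some a)
      then show ?thesis
        using column_const(1) c const_None_thin
        by (cases a, elim column_mapsE) (auto simp: map_sum_column_const described_maps_def)
    qed
  next
    case const
    then show ?thesis by (auto simp: map_sum_const described_maps_def)
  qed
qed

section \<open>Endomorphisms, affine maps and the upper bound for \<open>A_plus n\<close>\<close>

text \<open>If \<open>None\<close> has a nonzero image \<open>c\<close>, then
  \<open>g x + c = c = c + g x\<close> forces \<open>g x = c\<close>. Otherwise either one pair is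
  killed and then all are, or none is and the idempotents \<open>(i, i)\<close> are
  permuted.\<close>

lemma brandt_endo_cases:
  assumes "g \<in> brandt_endo n"
  obtains (const) c where "c \<in> brandt n" "g = const_map n c"
  | (perm) \<sigma> where "\<sigma> permutes {1..n}" "g None = None"
      "\<And>i j. i \<in> {1..n} \<Longrightarrow> j \<in> {1..n} \<Longrightarrow> g (Some (i, j)) = Some (\<sigma> i, \<sigma> j)"
proof -
  have g: "g \<in> brandt_maps n"
    and hom: "\<And>x y. x \<in> brandt n \<Longrightarrow> y \<in> brandt n \<Longrightarrow> brandt_add (g x) (g y) = g (brandt_add x y)"
    using assms by (auto simp: brandt_endo_def)
  show ?thesis
  proof (cases "g None")
    case (Some a)
    have "g x = Some a" if x: "x \<in> brandt n" for x
      using hom[OF x None_in_brandt] hom[OF None_in_brandt x] Some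
      by (cases a; cases "g x") (auto split: if_splits)
    moreover have a: "Some a \<in> brandt n"
      using brandt_maps_closed[OF g None_in_brandt] Some by simp
    ultimately have "g = const_map n (Some a)"
      by (intro brandt_maps_eqI[OF g const_map_in_brandt_maps]) simp_all
    then show ?thesis using a by (intro const)
  next
    case None
    show ?thesis
    proof (cases "\<exists>i\<in>{1..n}. \<exists>j\<in>{1..n}. g (Some (i, j)) = None")
      case True
      then obtain i j where ij: "i \<in> {1..n}" "j \<in> {1..n}" "g (Some (i, j)) = None" by blast
      \<comment> \<open>\<open>(k, l) = (k, i) + (i, j) + (j, l)\<close>, so a zero image at
        \<open>(i, j)\<close> spreads everywhere.\<close>
      have "g (Some (k, l)) = None" if "k \<in> {1..n}" "l \<in> {1..n}" for k l
      proof -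
        have "g (Some (k, j)) = None"
          using hom[of "Some (k, i)" "Some (i, j)"] ij that by simp
        then show ?thesis
          using hom[of "Some (k, j)" "Some (j, l)"] ij that by simp
      qed
      then have "g = const_map n None"
        using g None by (intro brandt_maps_eqI[of _ n]) auto
      then show ?thesis by (intro const[OF None_in_brandt])
    next
      case False
      have pair: "\<exists>k l. g (Some (i, j)) = Some (k, l)" if "i \<in> {1..n}" "j \<in> {1..n}" for i j
      proof -
        have "g (Some (i, j)) \<noteq> None" using False that(1,2) by metis
        then show ?thesis by simp
      qed
      have diag: "\<exists>k. g (Some (i, i)) = Some (k, k)" if i: "i \<in> {1..n}" for i
      proof -
        obtain k l where "g (Some (i, i)) = Some (k, l)" using pair[OF i i] by blast
        then show ?thesis using hom[of "Some (i, i)" "Some (i, i)"] i by (auto split: if_splits)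
      qed
      \<comment> \<open>Read off from the idempotents, and the identity outside
        \<open>{1..n}\<close> as \<open>permutes\<close> demands.\<close>
      define \<sigma> where "\<sigma> i = (if i \<in> {1..n} then fst (the (g (Some (i, i)))) else i)" for i
      have \<sigma>: "g (Some (i, i)) = Some (\<sigma> i, \<sigma> i)" if "i \<in> {1..n}" for i
        using diag[OF that] that by (auto simp: \<sigma>_def)
      have "inj_on \<sigma> {1..n}"
      proof (rule inj_onI, rule ccontr)
        \<comment> \<open>Distinct idempotents add to \<open>None\<close>, whereas equal nonzero
          idempotent images would not.\<close>
        fix i j assume "i \<in> {1..n}" "j \<in> {1..n}" "\<sigma> i = \<sigma> j" "i \<noteq> j"
        then show False using hom[of "Some (i, i)" "Some (j, j)"] \<sigma> None by simp
      qed
      moreover have "\<sigma> ` {1..n} \<subseteq> {1..n}"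
        using brandt_maps_closed[OF g] \<sigma> by (metis Some_in_brandt image_subsetI)
      ultimately have "bij_betw \<sigma> {1..n} {1..n}"
        by (simp add: bij_betw_def endo_inj_surj)
      then have \<sigma>_perm: "\<sigma> permutes {1..n}"
        by (rule bij_imp_permutes) (auto simp: \<sigma>_def)
      have "g (Some (i, j)) = Some (\<sigma> i, \<sigma> j)" if ij: "i \<in> {1..n}" "j \<in> {1..n}" for i j
      proof -
        obtain k l where kl: "g (Some (i, j)) = Some (k, l)" using pair[OF ij] by blast
        \<comment> \<open>The left and right identities of \<open>(i, j)\<close> determine the two
          coordinates of its image.\<close>
        have "brandt_add (g (Some (i, i))) (g (Some (i, j))) = g (Some (i, j))"
          "brandt_add (g (Some (i, j))) (g (Some (j, j))) = g (Some (i, j))"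
          using ij by (simp_all add: hom)
        then have "\<sigma> i = k" "l = \<sigma> j"
          unfolding kl \<sigma>[OF ij(1)] \<sigma>[OF ij(2)] by (simp_all split: if_splits)
        then show ?thesis by (simp add: kl)
      qed
      then show ?thesis using perm[OF \<sigma>_perm None] by blast
    qed
  qed
qed

lemma affine_maps_described:
  assumes "f \<in> affine_maps n"
  shows "f \<in> described_maps n"
proof -
  obtain g c where f: "f = map_sum n g (const_map n c)" and g: "g \<in> brandt_endo n"
    and c: "c \<in> brandt n"
    using assms by (auto simp: affine_maps_def)
  have gm: "g \<in> brandt_maps n" using g by (simp add: brandt_endo_def)
  from g show ?thesis
  proof (cases rule: brandt_endo_cases)
    case (const d)
    then show ?thesis using f c by (auto simp: map_sum_const described_maps_def)
  next
    case (perm \<sigma>)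
    from c show ?thesis
    proof (cases rule: brandt_cases)
      case zero
      have "f \<in> thin_maps n"
        unfolding f zero by (rule map_sum_thin[OF gm]) (auto simp: const_None_thin)
      then show ?thesis by (simp add: described_maps_def)
    next
      case (pair p q)
      \<comment> \<open>Adding \<open>(p, q)\<close> to \<open>(\<sigma> i, \<sigma> j)\<close>
        survives exactly when \<open>\<sigma> j = p\<close>, which names the source column.\<close>
      have i: "inv \<sigma> p \<in> {1..n}"
        using permutes_in_image[OF permutes_inv[OF perm(1)]] pair by blast
      have "f = column_map n (inv \<sigma> p) q \<sigma>"
        unfolding f
      proof (rule brandt_maps_eqI[of _ n])
        show "map_sum n g (const_map n c) \<in> brandt_maps n" using gm c by blast
        show "column_map n (inv \<sigma> p) q \<sigma> \<in> brandt_maps n" using perm pair by blast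
      qed (use perm pair permutes_inverses[OF perm(1)] in auto)
      then show ?thesis using i pair perm by (auto simp: described_maps_def)
    qed
  qed
qed

lemma A_plus_subset: "A_plus n \<subseteq> described_maps n"
proof
  show "f \<in> described_maps n" if "f \<in> A_plus n" for f
    using that
    by induction (auto intro: affine_maps_described described_maps_sum described_maps_mult)
qed

section \<open>Described maps inside \<open>A_plus n\<close>\<close>

text \<open>Apply \<open>\<sigma>\<close> to both coordinates, an endomorphism, and add the constant
  \<open>(\<sigma> p, q)\<close>: only column \<open>p\<close> survives.\<close>

lemma column_map_in_A_plus:
  assumes "p \<in> {1..n}" "q \<in> {1..n}" "\<sigma> permutes {1..n}"
  shows "column_map n p q \<sigma> \<in> A_plus n"
proof -
  define g where "g = (\<lambda>x\<in>brandt n. map_option (map_prod \<sigma> \<sigma>) x)"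
  have \<sigma>: "\<sigma> i \<in> {1..n} \<longleftrightarrow> i \<in> {1..n}" for i using permutes_in_image[OF assms(3)] .
  have inj: "\<sigma> i = \<sigma> j \<longleftrightarrow> i = j" for i j using inj_eq[OF permutes_inj[OF assms(3)]] .
  have gm: "g \<in> brandt_maps n"
    using \<sigma> by (auto simp: g_def brandt_maps_def brandt_def)
  have "g (brandt_add x y) = brandt_add (g x) (g y)" if "x \<in> brandt n" "y \<in> brandt n" for x y
    using that by (elim brandt_cases) (auto simp: g_def inj)
  then have "g \<in> brandt_endo n" using gm by (simp add: brandt_endo_def)
  moreover have c: "Some (\<sigma> p, q) \<in> brandt n" using assms \<sigma> by simp
  ultimately have "map_sum n g (const_map n (Some (\<sigma> p, q))) \<in> affine_maps n"
    unfolding affine_maps_def by blast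
  moreover have "map_sum n g (const_map n (Some (\<sigma> p, q))) = column_map n p q \<sigma>"
  proof (rule brandt_maps_eqI[of _ n])
    show "map_sum n g (const_map n (Some (\<sigma> p, q))) \<in> brandt_maps n" using gm c by blast
    show "column_map n p q \<sigma> \<in> brandt_maps n" using assms by blast
  qed (use inj in \<open>auto simp: g_def\<close>)
  ultimately show ?thesis by (metis A_plus.affine)
qed

text \<open>The constant at an idempotent \<open>(p, p)\<close> is an endomorphism, and
  \<open>(p, p) + (p, q) = (p, q)\<close>.\<close>

lemma const_map_in_A_plus:
  assumes "p \<in> {1..n}" "q \<in> {1..n}"
  shows "const_map n (Some (p, q)) \<in> A_plus n"
proof -
  have "const_map n (Some (p, p)) \<in> brandt_endo n"
    using assms by (auto simp: brandt_endo_def brandt_add_closed)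
  moreover have "Some (p, q) \<in> brandt n" using assms by simp
  ultimately have "map_sum n (const_map n (Some (p, p))) (const_map n (Some (p, q))) \<in> affine_maps n"
    unfolding affine_maps_def by blast
  then show ?thesis using assms by (simp add: map_sum_const A_plus.affine)
qed

text \<open>Adding \<open>(p, k)\<close> on the left to the column map from \<open>l\<close> to
  \<open>q\<close> leaves only the entry \<open>(k, l)\<close>, with value
  \<open>(p, k) + (k, q)\<close>.\<close>

lemma point_map_in_A_plus:
  assumes "a \<in> {1..n} \<times> {1..n}" "b \<in> {1..n} \<times> {1..n}"
  shows "point_map n a b \<in> A_plus n"
proof -
  obtain k l p q where ab: "a = (k, l)" "b = (p, q)" by fastforce
  have "point_map n a b = map_sum n (const_map n (Some (p, k))) (column_map n l q id)"
  proof (rule brandt_maps_eqI[of _ n])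
    show "map_sum n (const_map n (Some (p, k))) (column_map n l q id) \<in> brandt_maps n"
      using assms ab
      by (intro map_sum_in_brandt_maps const_map_in_brandt_maps column_map_in_brandt_maps
          permutes_id) auto
  qed (use assms ab in auto)
  also have "\<dots> \<in> A_plus n"
    using assms ab by (intro A_plus.sum const_map_in_A_plus column_map_in_A_plus permutes_id) auto
  finally show ?thesis .
qed

section \<open>Generated subsemigroups and the rank\<close>

lemma subsemigroup_gen_least:
  assumes "X \<subseteq> T" "\<And>x y. x \<in> T \<Longrightarrow> y \<in> T \<Longrightarrow> mul x y \<in> T"
  shows "subsemigroup_gen mul X \<subseteq> T"
proof
  show "x \<in> T" if "x \<in> subsemigroup_gen mul X" for x
    using that assms by induction auto
qed

lemma card_le_intermediate_rank:
  assumes "finite S" "U \<subseteq> S" "subsemigroup_gen mul U = S" "semigroup_independent mul U"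
  shows "card U \<le> intermediate_rank S mul"
proof -
  let ?C = "{card U | U. U \<subseteq> S \<and> subsemigroup_gen mul U = S \<and> semigroup_independent mul U}"
  \<comment> \<open>\<open>Max\<close> bounds its members only on finite sets, so finiteness of
    \<open>S\<close> is passed on to the cardinalities.\<close>
  have "?C \<subseteq> card ` Pow S" by blast
  then have "finite ?C" using assms(1) by (meson finite_Pow_iff finite_imageI finite_subset)
  then show ?thesis unfolding intermediate_rank_def using assms by (intro Max_ge) auto
qed

section \<open>The generating set and its size\<close>

definition gens :: "nat \<Rightarrow> (brandt_elem \<Rightarrow> brandt_elem) set" where
  "gens n = (\<lambda>j. column_map n 1 j (transpose 1 j)) ` {2..n} \<union>
    (\<lambda>j. column_map n j 1 id) ` {2..n} \<union>
    {point_map n (1, 1) (1, 1), const_map n (Some (1, 1))}"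

text \<open>The point \<open>(1, p)\<close> has a nonzero image, which reveals both columns.\<close>

lemma column_map_eqD:
  assumes "column_map n p q \<sigma> = column_map n r s \<tau>" "p \<in> {1..n}"
  shows "p = r \<and> q = s"
proof -
  have "column_map n p q \<sigma> (Some (1, p)) = column_map n r s \<tau> (Some (1, p))"
    using assms(1) by simp
  then show ?thesis using assms(2) by (auto split: if_splits)
qed

text \<open>For \<open>n \<ge> 2\<close> a column contains two points, so a column map has too large
  a support. For \<open>n = 1\<close> the classes meet.\<close>

lemma column_thin_disjoint:
  assumes "n \<ge> 2" "f \<in> column_maps n"
  shows "f \<notin> thin_maps n"
proof
  assume "f \<in> thin_maps n"
  from assms(2) obtain p q \<sigma> where *: "f = column_map n p q \<sigma>" "p \<in> {1..n}" by (rule column_mapsE)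
  then show False
    using thin_mapsD[OF \<open>f \<in> thin_maps n\<close>, of "Some (1, p)" "Some (2, p)"] assms(1) by simp
qed

lemma const_not_zero_preserving:
  "const_map n (Some c) \<notin> column_maps n" "const_map n (Some c) \<notin> thin_maps n"
  by (auto dest: column_maps_None thin_maps_None)

lemma point_map_not_const:
  assumes "a \<in> {1..n} \<times> {1..n}"
  shows "point_map n a b \<noteq> const_map n c"
proof
  assume eq: "point_map n a b = const_map n c"
  have "point_map n a b None = const_map n c None" "point_map n a b (Some a) = const_map n c (Some a)"
    using eq by simp_all
  moreover have "Some a \<in> brandt n" using assms by (cases a) simp
  ultimately show False by simp
qed

text \<open>Two families of \<open>n - 1\<close> maps, told apart by source and target columns, and
  two single maps: \<open>2 * (n - 1) + 2\<close>.\<close>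

lemma card_gens:
  assumes "n \<ge> 2"
  shows "card (gens n) = 2 * n"
proof -
  define A where "A = (\<lambda>j. column_map n 1 j (transpose 1 j)) ` {2..n}"
  define B where "B = (\<lambda>j. column_map n j 1 id) ` {2..n}"
  let ?z = "point_map n (1, 1) (1, 1)" and ?c = "const_map n (Some (1, 1))"
  have one: "1 \<in> {1..n}" using assms by simp
  have "inj_on (\<lambda>j. column_map n 1 j (transpose 1 j)) {2..n}"
    using column_map_eqD[OF _ one] by (intro inj_onI) blast
  then have "card A = n - 1"
    unfolding A_def by (subst card_image) auto
  moreover have "inj_on (\<lambda>j. column_map n j 1 id) {2..n}"
  proof (rule inj_onI)
    show "i = j" if "i \<in> {2..n}" "column_map n i 1 id = column_map n j 1 id" for i j
      using column_map_eqD[OF that(2)] that(1) by simp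
  qed
  then have "card B = n - 1"
    unfolding B_def by (subst card_image) auto
  moreover have "A \<inter> B = {}"
  proof -
    have "column_map n 1 j (transpose 1 j) \<noteq> column_map n k 1 id" if "k \<in> {2..n}" for j k
      using column_map_eqD[OF _ one, of j "transpose 1 j" k 1 id] that by auto
    then show ?thesis unfolding A_def B_def by blast
  qed
  moreover have fin: "finite A" "finite B" unfolding A_def B_def by simp_all
  ultimately have AB: "card (A \<union> B) = 2 * (n - 1)"
    by (simp add: card_Un_disjoint)
  have "A \<subseteq> column_maps n" "B \<subseteq> column_maps n"
    unfolding A_def B_def by (auto intro!: column_mapsI permutes_swap_id permutes_id)
  then have sub: "A \<union> B \<subseteq> column_maps n" by blast
  have z: "?z \<in> thin_maps n" using one by (intro point_map_thin) auto
  then have zn: "?z \<notin> A \<union> B" using column_thin_disjoint[OF assms] sub by blast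
  have "?c \<noteq> ?z" using z const_not_zero_preserving(2)[of n "(1, 1)"] by metis
  moreover have "?c \<notin> A \<union> B" using sub const_not_zero_preserving(1)[of n "(1, 1)"] by blast
  ultimately have cn: "?c \<notin> insert ?z (A \<union> B)" by blast
  have "gens n = insert ?c (insert ?z (A \<union> B))"
    unfolding gens_def A_def B_def by blast
  also have "card \<dots> = Suc (card (insert ?z (A \<union> B)))"
    by (rule card_insert_disjoint[OF _ cn]) (use fin in simp)
  also have "card (insert ?z (A \<union> B)) = Suc (card (A \<union> B))"
    by (rule card_insert_disjoint[OF _ zn]) (use fin in simp)
  finally show ?thesis using AB assms by simp
qed

section \<open>Generation\<close>

lemma gens_in_A_plus: "n \<ge> 2 \<Longrightarrow> gens n \<subseteq> A_plus n"
  by (auto simp: gens_def intro!: column_map_in_A_plus point_map_in_A_plus const_map_in_A_plus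
      permutes_swap_id permutes_id)

lemma described_maps_generated:
  assumes n: "n \<ge> 2"
  shows "described_maps n \<subseteq> subsemigroup_gen (map_mult n) (gens n)"
proof -
  let ?G = "subsemigroup_gen (map_mult n) (gens n)"
  have one: "1 \<in> {1..n}" using n by simp
  have tr: "transpose a b permutes {1..n}" if "a \<in> {1..n}" "b \<in> {1..n}" for a b
    using that by (rule permutes_swap_id)
  have mult: "column_map n p s (\<tau> \<circ> \<sigma>) \<in> ?G"
    if "column_map n p q \<sigma> \<in> ?G" "column_map n q s \<tau> \<in> ?G" "q \<in> {1..n}" "s \<in> {1..n}"
      "\<sigma> permutes {1..n}" "\<tau> permutes {1..n}" for p q s \<sigma> \<tau>
    using subsemigroup_gen.mult[OF that(1,2)] that by (simp add: column_map_mult)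
  have out: "column_map n 1 j (transpose 1 j) \<in> ?G" if "j \<in> {2..n}" for j
    using that by (intro subsemigroup_gen.base) (auto simp: gens_def)
  have into: "column_map n j 1 id \<in> ?G" if "j \<in> {2..n}" for j
    using that by (intro subsemigroup_gen.base) (auto simp: gens_def)
  \<comment> \<open>Out to column \<open>j\<close> and back; the return carries \<open>id\<close>,
    so the transposition remains.\<close>
  have loop: "column_map n 1 1 (transpose 1 j) \<in> ?G" if "j \<in> {2..n}" for j
    using mult[OF out into, of j] that one tr[OF one, of j] by (auto simp: permutes_id)
  \<comment> \<open>A transposition squares to the identity; \<open>j = 2\<close> exists because
    \<open>n \<ge> 2\<close>.\<close>
  have unit: "column_map n 1 1 id \<in> ?G"
    using mult[OF loop loop, of 2 2] n tr[OF one, of 2] by simp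
  have star: "column_map n 1 1 (transpose 1 j) \<in> ?G" if "j \<in> {1..n}" for j
    using loop[of j] unit that by (cases "j = 1") auto
  have transp: "column_map n 1 1 (transpose a b) \<in> ?G" if ab: "a \<in> {1..n}" "b \<in> {1..n}" for a b
  proof -
    consider "a = b" | "a = 1" | "b = 1" | "a \<noteq> b" "a \<noteq> 1" "b \<noteq> 1" by blast
    then show ?thesis
    proof cases
      case 4
      \<comment> \<open>Conjugating \<open>(1 b)\<close> by \<open>(1 a)\<close> yields
        \<open>(a b)\<close>.\<close>
      have "column_map n 1 1 (transpose 1 a \<circ> (transpose 1 b \<circ> transpose 1 a)) \<in> ?G"
        using ab one by (intro mult[of _ 1] star permutes_compose tr)
      moreover have "transpose 1 a \<circ> (transpose 1 b \<circ> transpose 1 a) = transpose a b"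
        using 4 by (auto simp: fun_eq_iff transpose_def)
      ultimately show ?thesis by simp
    qed (use unit star ab in \<open>auto simp: transpose_commute[of a 1]\<close>)
  qed
  have group: "column_map n 1 1 \<sigma> \<in> ?G" if "\<sigma> permutes {1..n}" for \<sigma>
    using finite_atLeastAtMost that
  proof (induction rule: permutes_rev_induct)
    case id
    then show ?case using unit .
  next
    case (swap a b p)
    then show ?case by (intro mult[of _ 1] transp tr one)
  qed
  have column: "column_map n p q \<sigma> \<in> ?G"
    if pq: "p \<in> {1..n}" "q \<in> {1..n}" and \<sigma>: "\<sigma> permutes {1..n}" for p q \<sigma>
  proof -
    have "column_map n p 1 id \<in> ?G" using into[of p] unit pq by (cases "p = 1") auto
    moreover have "column_map n 1 q \<sigma> \<in> ?G"
    proof (cases "q = 1")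
      case False
      \<comment> \<open>The generator into column \<open>q\<close> brings along
        \<open>(1 q)\<close>, so the loop before it carries an extra \<open>(1 q)\<close> to cancel
        it.\<close>
      have "column_map n 1 q (transpose 1 q \<circ> (transpose 1 q \<circ> \<sigma>)) \<in> ?G"
        using False pq one \<sigma> by (intro mult[of _ 1] group out permutes_compose tr) auto
      then show ?thesis by (simp add: o_assoc)
    qed (use group \<sigma> in simp)
    ultimately have "column_map n p q (\<sigma> \<circ> id) \<in> ?G"
      using pq one \<sigma> by (intro mult[of _ 1]) (auto simp: permutes_id)
    then show ?thesis by simp
  qed
  have point: "point_map n a b \<in> ?G" if "a \<in> {1..n} \<times> {1..n}" "b \<in> {1..n} \<times> {1..n}" for a b
  proof -
    obtain k l p q where ab: "a = (k, l)" "b = (p, q)" by fastforce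
    \<comment> \<open>\<open>?l\<close> carries \<open>(k, l)\<close> to \<open>(1, 1)\<close>,
      \<open>?m\<close> keeps only that point, and \<open>?r\<close> carries it to
      \<open>(p, q)\<close>.\<close>
    let ?l = "column_map n l 1 (transpose 1 k)" and ?m = "point_map n (1, 1) (1, 1)"
      and ?r = "column_map n 1 q (transpose 1 p)"
    have t: "transpose 1 k permutes {1..n}" "transpose 1 p permutes {1..n}"
      using that ab one tr by auto
    have "?m \<in> ?G" by (rule subsemigroup_gen.base) (simp add: gens_def)
    then have "map_mult n (map_mult n ?l ?m) ?r \<in> ?G"
      using that ab one t by (intro subsemigroup_gen.mult column) auto
    moreover have "map_mult n (map_mult n ?l ?m) ?r = point_map n a b"
    proof (rule brandt_maps_eqI[of _ n])
      show "map_mult n (map_mult n ?l ?m) ?r \<in> brandt_maps n"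
        using that ab one t by (intro map_mult_in_brandt_maps) auto
      show "map_mult n (map_mult n ?l ?m) ?r (Some (i, j)) = point_map n a b (Some (i, j))"
        if "i \<in> {1..n}" "j \<in> {1..n}" for i j
        using that ab one permutes_in_image[OF t(1), of i] by (auto simp: transpose_eq_iff)
    qed (use that in auto)
    ultimately show ?thesis by simp
  qed
  have c: "const_map n (Some (1, 1)) \<in> ?G"
    by (rule subsemigroup_gen.base) (simp add: gens_def)
  have const: "const_map n (Some (p, q)) \<in> ?G" if "p \<in> {1..n}" "q \<in> {1..n}" for p q
    using subsemigroup_gen.mult[OF c column[OF one that(2) tr[OF one that(1)]]] that one
      column_map_in_brandt_maps[OF that(2) tr[OF one that(1)]]
    by (simp add: map_mult_const_left)
  \<comment> \<open>A zeta supported at \<open>(2, 1)\<close> sends \<open>(1, 1)\<close> to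
    \<open>None\<close>, which turns the constant into zero.\<close>
  have "map_mult n (const_map n (Some (1, 1))) (point_map n (2, 1) (1, 1)) \<in> ?G"
    using n by (intro subsemigroup_gen.mult c point) auto
  then have "const_map n None \<in> ?G"
    using n one by (simp add: map_mult_const_left point_map_in_brandt_maps)
  then show ?thesis
    using column point const
    by (auto simp: described_maps_def column_maps_def thin_maps_def point_maps_def elim!: brandt_cases)
qed

text \<open>A circle of inclusions: the generated subsemigroup lies in \<open>A_plus n\<close>, that
  in \<open>described_maps n\<close>, and that in the generated subsemigroup.\<close>

lemma gens_generate:
  assumes "n \<ge> 2"
  shows "subsemigroup_gen (map_mult n) (gens n) = A_plus n"
  using subsemigroup_gen_least[OF gens_in_A_plus[OF assms], of "map_mult n"] A_plus.mult
    described_maps_generated[OF assms] A_plus_subset by blast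

section \<open>Independence\<close>

text \<open>A closed set \<open>T\<close> that contains the other generators but misses
  \<open>a\<close> certifies that \<open>a\<close> is not redundant.\<close>

lemma semigroup_independentI:
  assumes "\<And>a. a \<in> U \<Longrightarrow> \<exists>T. U - {a} \<subseteq> T \<and> a \<notin> T \<and> (\<forall>x\<in>T. \<forall>y\<in>T. mul x y \<in> T)"
  shows "semigroup_independent mul U"
  unfolding semigroup_independent_def
proof
  fix a assume "a \<in> U"
  from assms[OF this] obtain T
    where T: "U - {a} \<subseteq> T" "a \<notin> T" "\<forall>x\<in>T. \<forall>y\<in>T. mul x y \<in> T"
    by blast
  have "subsemigroup_gen mul (U - {a}) \<subseteq> T"
    using T(3) by (intro subsemigroup_gen_least[OF T(1)]) blast
  then show "a \<notin> subsemigroup_gen mul (U - {a})" using T(2) by blast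
qed

lemma gens_independent:
  assumes n: "n \<ge> 2"
  shows "semigroup_independent (map_mult n) (gens n)"
proof (rule semigroup_independentI)
  let ?A = "\<lambda>j. column_map n 1 j (transpose 1 j)" and ?B = "\<lambda>j. column_map n j 1 id"
  let ?z = "point_map n (1, 1) (1, 1)" and ?c = "const_map n (Some (1, 1))"
  have one: "1 \<in> {1..n}" using n by simp
  \<comment> \<open>Source column in \<open>P\<close>, target column in \<open>Q\<close>. A nonzero
    product inherits its source from the first factor and its target from the second, so the family
    is closed up to thin maps.\<close>
  define C where "C P Q = {column_map n p q \<sigma> | p q \<sigma>.
    p \<in> {1..n} \<inter> P \<and> q \<in> {1..n} \<inter> Q \<and> \<sigma> permutes {1..n}}" for P Q
  have C_sub: "C P Q \<subseteq> column_maps n" for P Q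
    by (auto simp: C_def)
  have C_mult: "map_mult n f g \<in> C P Q \<union> thin_maps n" if "f \<in> C P Q" "g \<in> C P Q" for f g P Q
    using that const_None_thin permutes_compose unfolding C_def
    by (fastforce simp: column_map_mult)
  have A_in: "?A j \<in> C P Q" if "j \<in> {2..n} \<inter> Q" "1 \<in> P" for j P Q
    using that one permutes_swap_id[OF one, of j] unfolding C_def by fastforce
  have B_in: "?B j \<in> C P Q" if "j \<in> {2..n} \<inter> P" "1 \<in> Q" for j P Q
    using that one permutes_id[of "{1..n}"] unfolding C_def by fastforce
  have z_in: "?z \<in> thin_maps n" and c_in: "?c \<in> const_map n ` brandt n"
    using one by (auto intro: point_map_thin)
  have cols: "?A j \<in> column_maps n" "?B j \<in> column_maps n" if "j \<in> {2..n}" for j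
    using that A_in[of j UNIV UNIV] B_in[of j UNIV UNIV] C_sub by auto
  have not_const: "f \<notin> const_map n ` brandt n" if "f \<in> column_maps n" for f
  proof
    assume "f \<in> const_map n ` brandt n"
    then obtain d where d: "f = const_map n d" by blast
    then have "d = None" using column_maps_None[OF that] by simp
    then show False using column_thin_disjoint[OF n that] d const_None_thin by simp
  qed
  have not_thin_const: "f \<notin> C P Q \<union> thin_maps n \<union> const_map n ` brandt n"
    if "f \<in> column_maps n" "f \<notin> C P Q" for f P Q
    using that not_const[OF that(1)] column_thin_disjoint[OF n that(1)] by simp
  have closed: "\<forall>x\<in>T. \<forall>y\<in>T. map_mult n x y \<in> T"
    if "T = C P Q \<union> thin_maps n \<union> const_map n ` brandt n" for T P Q
    unfolding that by (intro ballI columns_thin_consts_mult[OF C_sub C_mult])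
  fix a assume "a \<in> gens n"
  then consider (A) j where "j \<in> {2..n}" "a = ?A j" | (B) j where "j \<in> {2..n}" "a = ?B j"
    | (z) "a = ?z" | (c) "a = ?c"
    unfolding gens_def by blast
  then show "\<exists>T. gens n - {a} \<subseteq> T \<and> a \<notin> T \<and> (\<forall>x\<in>T. \<forall>y\<in>T. map_mult n x y \<in> T)"
  proof cases
    case A
    \<comment> \<open>Forbids target column \<open>j\<close>: the other outgoing maps end elsewhere,
      and the returning ones end in \<open>1\<close>, which differs from
      \<open>j \<ge> 2\<close>.\<close>
    let ?T = "C UNIV (- {j}) \<union> thin_maps n \<union> const_map n ` brandt n"
    have "?A k \<in> C UNIV (- {j})" if "k \<in> {2..n}" "?A k \<noteq> a" for k
      using that A A_in[of k "- {j}" UNIV] by auto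
    moreover have "?B k \<in> C UNIV (- {j})" if "k \<in> {2..n}" for k
      using that A(1) B_in[of k UNIV "- {j}"] by auto
    ultimately have "gens n - {a} \<subseteq> ?T" using z_in c_in by (auto simp: gens_def)
    moreover have "a \<notin> C UNIV (- {j})"
      using A one by (auto simp: C_def dest!: column_map_eqD)
    then have "a \<notin> ?T" using cols(1)[OF A(1)] unfolding A(2) by (intro not_thin_const)
    ultimately show ?thesis using closed[OF refl] by (intro exI[of _ ?T] conjI)
  next
    case B
    \<comment> \<open>The mirror image, with source column \<open>j\<close> forbidden.\<close>
    let ?T = "C (- {j}) UNIV \<union> thin_maps n \<union> const_map n ` brandt n"
    have "?B k \<in> C (- {j}) UNIV" if "k \<in> {2..n}" "?B k \<noteq> a" for k
      using that B B_in[of k "- {j}" UNIV] by auto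
    moreover have "?A k \<in> C (- {j}) UNIV" if "k \<in> {2..n}" for k
      using that B(1) A_in[of k UNIV "- {j}"] by auto
    ultimately have "gens n - {a} \<subseteq> ?T" using z_in c_in by (auto simp: gens_def)
    moreover have "a \<notin> C (- {j}) UNIV"
      using B one by (auto simp: C_def dest!: column_map_eqD)
    then have "a \<notin> ?T" using cols(2)[OF B(1)] unfolding B(2) by (intro not_thin_const)
    ultimately show ?thesis using closed[OF refl] by (intro exI[of _ ?T] conjI)
  next
    case z
    \<comment> \<open>Column maps with mismatched columns multiply to zero, which is available here
      as a constant.\<close>
    let ?T = "column_maps n \<union> const_map n ` brandt n"
    have "gens n - {a} \<subseteq> ?T" using z z_in c_in cols by (auto simp: gens_def)
    moreover have "a \<notin> ?T"
      using z z_in column_thin_disjoint[OF n] point_map_not_const[of "(1, 1)" n] one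
      by auto
    moreover have "\<forall>x\<in>?T. \<forall>y\<in>?T. map_mult n x y \<in> ?T"
    proof (intro ballI, rule consts_mult[OF column_maps_subset])
      show "map_mult n f g \<in> ?T" if "f \<in> column_maps n" "g \<in> column_maps n" for f g
        using that by (elim column_mapsE) (auto simp: column_map_mult intro: permutes_compose)
    qed
    ultimately show ?thesis by (intro exI[of _ ?T] conjI)
  next
    case c
    let ?T = "column_maps n \<union> thin_maps n"
    have "gens n - {a} \<subseteq> ?T" using c z_in c_in cols by (auto simp: gens_def)
    moreover have "a \<notin> ?T" using c const_not_zero_preserving by blast
    moreover have "\<forall>x\<in>?T. \<forall>y\<in>?T. map_mult n x y \<in> ?T"
      by (intro ballI zero_preserving_mult[OF subset_refl column_maps_mult])
    ultimately show ?thesis by (intro exI[of _ ?T] conjI)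
  qed
qed

theorem theorem4p4:
  fixes n :: nat
  assumes "n \<ge> 2"
  shows "intermediate_rank (A_plus n) (map_mult n) \<ge> 2 * n"
proof -
  have "finite (brandt_maps n)" by (simp add: brandt_maps_def finite_PiE finite_brandt)
  then have "finite (A_plus n)"
    using A_plus_subset described_maps_subset by (meson finite_subset)
  then have "card (gens n) \<le> intermediate_rank (A_plus n) (map_mult n)"
    using gens_in_A_plus[OF assms] gens_generate[OF assms] gens_independent[OF assms]
    by (rule card_le_intermediate_rank)
  then show ?thesis using card_gens[OF assms] by simp
qed

end
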